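(* Let $R$ be a commutative ring, let $n\in\mathbb{N}$ with $n\geq 1$, and let $A\colon R\to R$ be an additive mapping. Then $A\in\mathscr{D}_{n}(R)$ if and only if $$\sum_{i=0}^{n}(-1)^i\sum_{\mathrm{card}(I)=i}\left(\prod_{j\in I}x_{j}\right)\cdot A\left(\prod_{k\in\{1,\ldots,n+1\}\setminus I}x_{k}\right)=0$$ for all $x_{1},\ldots,x_{n+1}\in R$.
   Context: A mapping $f\colon R\to R$ on a ring is additive if $f(x+y)=f(x)+f(y)$ for all $x,y\in R$. Higher order derivations: let $R$ be a ring. The identically zero map is the only derivation of order zero. For each integer $n\ge 1$, an additive mapping $f\colon R\to R$ is a derivation of order $n$ if there exists $B\colon R\times R\to R$ such that $B$ is a bi-derivation of order $n-1$ (that is, $B$ is a derivation of order $n-1$ in each variable, the other variable being fixed) and $f(xy)-xf(y)-f(x)y=B(x,y)$ for all $x,y\in R$. The set of derivations of order $n$ of $R$ is denoted by $\mathscr{D}_{n}(R)$. The inner sum runs over all subsets $I\subset\{1,\ldots,n+1\}$ of cardinality $i$. For $I=\emptyset$ the empty product $\prod_{j\in I}x_j$ is understood as an omitted factor, so that the corresponding term is $A(x_1\cdots x_{n+1})$. *)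

theory Defs
  imports Complex_Main
begin

text \<open>
  Rings are not assumed to be unital, so \<^const>\<open>prod\<close>, which needs a unit, is not available.
  \<open>nonempty_prod x K\<close> is the product of the \<open>x k\<close> over a finite nonempty index set \<open>K\<close>;
  the choice of the minimum as starting point is immaterial by \<open>nonempty_prod_insert\<close>.
\<close>

definition nonempty_prod :: "(nat \<Rightarrow> 'a::comm_ring) \<Rightarrow> nat set \<Rightarrow> 'a" where
  "nonempty_prod x K = Finite_Set.fold (\<lambda>k p. x k * p) (x (Min K)) (K - {Min K})"

lemma comp_fun_commute_times: "comp_fun_commute (\<lambda>k p. x k * (p :: 'a::comm_ring))"
  by standard (simp add: fun_eq_iff mult.left_commute)

lemma nonempty_prod_singleton: "nonempty_prod x {k} = x k"
  by (simp add: nonempty_prod_def)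

lemma nonempty_prod_insert:
  assumes "finite K" "K \<noteq> {}" "k \<notin> K"
  shows "nonempty_prod x (insert k K) = x k * nonempty_prod x K"
proof -
  interpret comp_fun_commute "\<lambda>k p. x k * p"
    by (rule comp_fun_commute_times)
  define m where "m = Min K"
  have m: "m \<in> K" using assms by (simp add: m_def)
  have km: "k \<noteq> m" using m assms by auto
  have min: "Min (insert k K) = min k m" using assms by (simp add: m_def)
  show ?thesis
  proof (cases "k < m")
    case True
    have "K = insert m (K - {m})" using m by auto
    then have "Finite_Set.fold (\<lambda>k p. x k * p) (x k) K
        = x m * Finite_Set.fold (\<lambda>k p. x k * p) (x k) (K - {m})"
      using assms by (metis Diff_iff finite_Diff fold_insert singletonI)
    also have "\<dots> = Finite_Set.fold (\<lambda>k p. x k * p) (x m * x k) (K - {m})"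
      using assms by (simp add: fold_fun_left_comm)
    also have "\<dots> = x k * Finite_Set.fold (\<lambda>k p. x k * p) (x m) (K - {m})"
      using assms fold_fun_left_comm[of "K - {m}" k "x m"] by (simp only: mult.commute[of "x m"] finite_Diff)
    finally show ?thesis
      using True assms by (simp add: nonempty_prod_def min m_def[symmetric])
  next
    case False
    then have "insert k K - {min k m} = insert k (K - {m})" using km by auto
    then show ?thesis
      using False assms by (simp add: nonempty_prod_def min m_def[symmetric])
  qed
qed

lemma nonempty_prod_eq_prod:
  fixes x :: "nat \<Rightarrow> 'a::comm_ring_1"
  assumes "finite K" "K \<noteq> {}"
  shows "nonempty_prod x K = prod x K"
  using assms
  by (induction K rule: finite_ne_induct)
    (simp_all add: nonempty_prod_singleton nonempty_prod_insert)

primrec higher_derivations :: "nat \<Rightarrow> ('a::ring \<Rightarrow> 'a) set" where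
  "higher_derivations 0 = {\<lambda>x. 0}"
| "higher_derivations (Suc n) =
    {f. additive f \<and>
        (\<exists>B. (\<forall>y. (\<lambda>x. B x y) \<in> higher_derivations n) \<and>
             (\<forall>x. (\<lambda>y. B x y) \<in> higher_derivations n) \<and>
             (\<forall>x y. f (x * y) - x * f y - f x * y = B x y))}"

text \<open>
  \<open>signed i s\<close> is \<open>(-1)\<^sup>i s\<close>; in a ring without unit the sign is not a ring element.
\<close>

definition signed :: "nat \<Rightarrow> 'a::ab_group_add \<Rightarrow> 'a" where
  "signed i s = (if even i then s else - s)"

end

theory Submission
  imports Defs
begin

text \<open>
  Write \<open>P\<^sub>n(A)\<close> for the alternating sum and \<open>B(x, y) = A(xy) - xA(y) - A(x)y\<close>. Splitting the
  index sets of \<open>P\<^sub>n(A)(x\<^sub>1, \<dots>, x\<^sub>n, y)\<close> according to whether they contain the last index gives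
  \<open>P\<^sub>n(A)(x\<^sub>1, \<dots>, x\<^sub>n, y) = P\<^sub>n\<^sub>-\<^sub>1(B(\<cdot>, y))(x\<^sub>1, \<dots>, x\<^sub>n)\<close>, the difference of the two sides being
  \<open>x\<^sub>1 \<cdots> x\<^sub>n A(y)\<close> times the alternating sum \<open>0\<close> of binomial coefficients. Since \<open>B\<close> is symmetric
  and biadditive, induction on \<open>n\<close> finishes the proof; it starts at \<open>n = 0\<close>, where
  \<open>P\<^sub>0(A)(x\<^sub>1) = A(x\<^sub>1)\<close>.
\<close>

lemma signed_Suc [simp]: "signed (Suc i) s = - signed i s"
  by (simp add: signed_def)

lemma signed_diff: "signed i (s - t) = signed i s - signed i t"
  by (simp add: signed_def)

lemma signed_sum: "signed i (sum f S) = (\<Sum>s\<in>S. signed i (f s))"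
  by (simp add: signed_def sum_negf)

lemma inj_on_insert_Pow:
  assumes "k \<notin> S"
  shows "inj_on (insert k) (Pow S)"
proof (rule inj_onI)
  fix I J assume "I \<in> Pow S" "J \<in> Pow S" "insert k I = insert k J"
  moreover from this have "k \<notin> I" "k \<notin> J" using assms by auto
  ultimately show "I = J" by (simp add: insert_ident)
qed

lemma sum_Pow_insert:
  assumes "finite S" "k \<notin> S"
  shows "sum f (Pow (insert k S)) = sum f (Pow S) + (\<Sum>I\<in>Pow S. f (insert k I))"
  using assms inj_on_insert_Pow[OF assms(2)]
  by (subst Pow_insert, subst sum.union_disjoint) (auto simp: sum.reindex)

text \<open>Adding or removing one fixed \<open>k\<close> in \<open>S\<close> pairs the subsets of
  \<open>S\<close> into couples of opposite sign.\<close>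

lemma sum_signed_card_Pow:
  assumes "finite S" "S \<noteq> {}"
  shows "(\<Sum>I\<in>Pow S. signed (card I) c) = 0"
proof -
  obtain k T where S: "S = insert k T" "k \<notin> T"
    using assms by (meson ex_in_conv mk_disjoint_insert)
  then have T: "finite T" using assms by simp
  have "(\<Sum>I\<in>Pow T. signed (card (insert k I)) c) = (\<Sum>I\<in>Pow T. - signed (card I) c)"
    using S(2) T by (intro sum.cong refl) (metis PowD card_insert_disjoint finite_subset signed_Suc subsetD)
  then show ?thesis
    using S T by (simp add: sum_Pow_insert sum_negf)
qed

lemma nonempty_prod_union_disjoint:
  assumes "finite I" "I \<noteq> {}" "finite J" "J \<noteq> {}" "I \<inter> J = {}"
  shows "nonempty_prod x (I \<union> J) = nonempty_prod x I * nonempty_prod x J"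
  using assms
  by (induction I rule: finite_ne_induct)
    (simp_all add: nonempty_prod_singleton nonempty_prod_insert mult.assoc)

lemma nonempty_prod_cong:
  assumes "finite K" "K \<noteq> {}" "\<And>k. k \<in> K \<Longrightarrow> x k = y k"
  shows "nonempty_prod x K = nonempty_prod y K"
  using assms
  by (induction K rule: finite_ne_induct)
    (simp_all add: nonempty_prod_singleton nonempty_prod_insert)

text \<open>Without a unit the empty product is no ring element, so multiplication by a possibly
  empty product is encoded as an operator, the identity for \<open>I = {}\<close>.\<close>

definition prod_times :: "(nat \<Rightarrow> 'a::comm_ring) \<Rightarrow> nat set \<Rightarrow> 'a \<Rightarrow> 'a" where
  "prod_times x I a = (if I = {} then a else nonempty_prod x I * a)"

lemma prod_times_diff: "prod_times x I (a - b) = prod_times x I a - prod_times x I b"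
  by (simp add: prod_times_def algebra_simps)

lemma prod_times_mult: "prod_times x I (a * b) = a * prod_times x I b"
  by (simp add: prod_times_def mult.left_commute)

lemma prod_times_insert:
  assumes "finite I" "k \<notin> I"
  shows "prod_times x (insert k I) a = x k * prod_times x I a"
  using assms by (simp add: prod_times_def nonempty_prod_singleton nonempty_prod_insert mult.assoc)

lemma prod_times_nonempty_prod_Diff:
  assumes "finite S" "I \<subset> S"
  shows "prod_times x I (nonempty_prod x (S - I)) = nonempty_prod x S"
proof (cases "I = {}")
  case False
  have S: "S = I \<union> (S - I)" using assms by blast
  have "nonempty_prod x (I \<union> (S - I)) = nonempty_prod x I * nonempty_prod x (S - I)"
    using assms False by (intro nonempty_prod_union_disjoint) (auto intro: finite_subset)
  then show ?thesis using False S by (simp only: prod_times_def if_False)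
qed (simp add: prod_times_def)

lemma prod_times_cong:
  assumes "finite I" "\<And>k. k \<in> I \<Longrightarrow> x k = y k"
  shows "prod_times x I a = prod_times y I a"
  using assms nonempty_prod_cong[of I x y] by (simp add: prod_times_def)

text \<open>All cardinalities are summed at once and over any index set, so that one index can be
  split off. \<open>I = S\<close> is left out because \<open>A\<close> would receive an empty
  product.\<close>

definition alternating_sum :: "('a::comm_ring \<Rightarrow> 'a) \<Rightarrow> (nat \<Rightarrow> 'a) \<Rightarrow> nat set \<Rightarrow> 'a" where
  "alternating_sum A x S =
    (\<Sum>I\<in>Pow S - {S}. signed (card I) (prod_times x I (A (nonempty_prod x (S - I)))))"

lemma alternating_sum_singleton: "alternating_sum A x {k} = A (x k)"
proof -
  have "Pow {k} - {{k}} = {{}}" by auto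
  then show ?thesis
    by (simp add: alternating_sum_def prod_times_def signed_def nonempty_prod_singleton)
qed

lemma alternating_sum_cong:
  assumes "finite S" "\<And>k. k \<in> S \<Longrightarrow> x k = y k"
  shows "alternating_sum A x S = alternating_sum A y S"
  unfolding alternating_sum_def
proof (rule sum.cong[OF refl])
  fix I assume I: "I \<in> Pow S - {S}"
  have "nonempty_prod x (S - I) = nonempty_prod y (S - I)"
    using I assms by (intro nonempty_prod_cong) auto
  moreover have "prod_times x I a = prod_times y I a" for a
    using I assms by (intro prod_times_cong) (auto intro: finite_subset)
  ultimately show "signed (card I) (prod_times x I (A (nonempty_prod x (S - I)))) =
      signed (card I) (prod_times y I (A (nonempty_prod y (S - I))))"
    by simp
qed

text \<open>Up to sign, the Hochschild coboundary of \<open>A\<close>.\<close>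

definition leibniz_defect :: "('a::comm_ring \<Rightarrow> 'a) \<Rightarrow> 'a \<Rightarrow> 'a \<Rightarrow> 'a" where
  "leibniz_defect A x y = A (x * y) - x * A y - A x * y"

lemma leibniz_defect_commute: "leibniz_defect A x y = leibniz_defect A y x"
  by (simp add: leibniz_defect_def algebra_simps)

lemma additive_leibniz_defect:
  assumes "additive A"
  shows "additive (\<lambda>x. leibniz_defect A x y)"
  using assms by (simp add: additive_def leibniz_defect_def algebra_simps)

lemma alternating_sum_insert:
  assumes S: "finite S" "S \<noteq> {}" and k: "k \<notin> S"
  shows "alternating_sum A x (insert k S) = alternating_sum (\<lambda>z. leibniz_defect A z (x k)) x S"
proof -
  \<comment> \<open>\<open>t K I\<close> is the summand of \<open>I\<close> in the sum over
    \<open>K\<close>; \<open>c\<close> is, up to sign, the summand of \<open>S\<close> in the sum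
    over \<open>insert k S\<close>.\<close>
  define t where "t K I = signed (card I) (prod_times x I (A (nonempty_prod x (K - I))))" for K I
  define c where "c = nonempty_prod x S * A (x k)"
  define P where "P = Pow S - {S}"
  have P: "I \<subseteq> S" "I \<noteq> S" "k \<notin> I" "finite I" if "I \<in> P" for I
    using that S(1) k by (auto simp: P_def intro: finite_subset)
  have inj: "inj_on (insert k) P"
    using inj_on_insert_Pow[OF k] unfolding P_def by (rule inj_on_subset) blast
  \<comment> \<open>A proper subset of \<open>insert k S\<close> without \<open>k\<close> may be all
    of \<open>S\<close>, whereas one with \<open>k\<close> comes from a proper subset of
    \<open>S\<close>. Hence \<open>S\<close> is the only summand without a partner.\<close>
  have eq: "Pow (insert k S) - {insert k S} = insert S P \<union> insert k ` P"
  proof -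
    have "Pow S = insert S P" by (auto simp: P_def)
    moreover have "insert k I \<noteq> insert k S" if "I \<in> P" for I
      using P[OF that] k by (simp add: insert_ident)
    moreover have "insert k S \<notin> insert S P"
      using k P by blast
    ultimately show ?thesis by (auto simp: Pow_insert)
  qed
  have "finite P" "S \<notin> P" using S(1) by (simp_all add: P_def)
  moreover have "insert S P \<inter> insert k ` P = {}"
    using k P by blast
  ultimately have "alternating_sum A x (insert k S) =
      t (insert k S) S + (\<Sum>I\<in>P. t (insert k S) I) + (\<Sum>I\<in>P. t (insert k S) (insert k I))"
    using inj unfolding alternating_sum_def t_def[symmetric] eq
    by (subst sum.union_disjoint) (simp_all add: sum.reindex)
  also have "t (insert k S) S = signed (card S) c"
  proof -
    have "insert k S - S = {k}" using k by auto
    then show ?thesis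
      using S by (simp add: t_def c_def prod_times_def nonempty_prod_singleton)
  qed
  \<comment> \<open>Since the signs over all of \<open>Pow S\<close> cancel, the lone summand of
    \<open>S\<close> can be spread over \<open>P\<close>, one signed \<open>- c\<close> for each
    \<open>I\<close>.\<close>
  also have "\<dots> = - (\<Sum>I\<in>P. signed (card I) c)"
    using sum_signed_card_Pow[OF S, of c] S(1) sum.remove[of "Pow S" S "\<lambda>I. signed (card I) c"]
    by (simp add: eq_neg_iff_add_eq_0 P_def)
  finally have "alternating_sum A x (insert k S) =
      (\<Sum>I\<in>P. t (insert k S) I - signed (card I) c + t (insert k S) (insert k I))"
    by (simp add: sum.distrib sum_subtractf)
  also have "\<dots> = alternating_sum (\<lambda>z. leibniz_defect A z (x k)) x S"
    unfolding alternating_sum_def P_def[symmetric]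
  proof (rule sum.cong[OF refl])
    fix I assume I: "I \<in> P"
    let ?p = "nonempty_prod x (S - I)"
    have ins: "insert k S - I = insert k (S - I)" "insert k S - insert k I = S - I"
      using P[OF I] k by auto
    have "S - I \<noteq> {}" using P[OF I] by auto
    then have p: "nonempty_prod x (insert k (S - I)) = ?p * x k"
      using S k by (simp add: nonempty_prod_insert mult.commute)
    \<comment> \<open>The products over \<open>I\<close> and \<open>S - I\<close> recombine to the
      product over \<open>S\<close>, so the middle term of the defect contributes the same
      \<open>c\<close> for every \<open>I\<close>.\<close>
    have c: "prod_times x I (?p * A (x k)) = c"
      using P[OF I] S prod_times_nonempty_prod_Diff[of S I x]
        prod_times_mult[of x I "A (x k)" ?p]
      by (simp add: c_def psubset_eq mult.commute)
    have d: "prod_times x I (A ?p * x k) = x k * prod_times x I (A ?p)"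
      by (simp add: prod_times_mult mult.commute[of _ "x k"])
    show "t (insert k S) I - signed (card I) c + t (insert k S) (insert k I) =
        signed (card I) (prod_times x I (leibniz_defect A ?p (x k)))"
      using P[OF I] by (simp add: t_def ins p leibniz_defect_def prod_times_diff signed_diff c d
          prod_times_insert)
  qed
  finally show ?thesis .
qed

text \<open>The equation in the definition forces \<open>B\<close> to be the Leibniz defect, which
  is symmetric by commutativity, so the conditions on its two variables coincide.\<close>

lemma higher_derivations_Suc_iff:
  "A \<in> higher_derivations (Suc n) \<longleftrightarrow>
    additive A \<and> (\<forall>y. (\<lambda>x. leibniz_defect A x y) \<in> higher_derivations n)"
proof -
  have "(\<forall>x y. A (x * y) - x * A y - A x * y = B x y) \<longleftrightarrow> B = leibniz_defect A" for B
    by (auto simp: leibniz_defect_def fun_eq_iff)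
  moreover have "(\<forall>x. (\<lambda>y. leibniz_defect A x y) \<in> higher_derivations n) \<longleftrightarrow>
      (\<forall>y. (\<lambda>x. leibniz_defect A x y) \<in> higher_derivations n)"
    by (subst leibniz_defect_commute) (rule refl)
  ultimately show ?thesis by simp
qed

lemma higher_derivations_iff_alternating_sum:
  fixes A :: "'a::comm_ring \<Rightarrow> 'a"
  assumes "additive A"
  shows "A \<in> higher_derivations n \<longleftrightarrow> (\<forall>x. alternating_sum A x {1..n+1} = 0)"
  using assms
\<comment> \<open>\<open>A\<close> is generalised because the induction hypothesis is applied to the
  additive maps \<open>leibniz_defect A _ y\<close>.\<close>
proof (induction n arbitrary: A)
  case 0
  have "(\<forall>x :: nat \<Rightarrow> 'a. A (x 1) = 0) \<longleftrightarrow> A = (\<lambda>x. 0)"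
  proof (intro iffI allI ext)
    fix z assume "\<forall>x :: nat \<Rightarrow> 'a. A (x 1) = 0"
    then show "A z = 0" by (rule allE[of _ "\<lambda>_. z"])
  qed simp
  then show ?case
    by (simp add: alternating_sum_singleton)
next
  case (Suc n)
  let ?B = "\<lambda>y x. leibniz_defect A x y"
  have step: "alternating_sum A x {1..Suc n + 1} = alternating_sum (?B (x (n + 2))) x {1..n + 1}"
    for x
  proof -
    have "{1..Suc n + 1} = insert (n + 2) {1..n + 1}" by auto
    then show ?thesis
      using alternating_sum_insert[of "{1..n + 1}" "n + 2" A x] by simp
  qed
  have "A \<in> higher_derivations (Suc n) \<longleftrightarrow> (\<forall>y x. alternating_sum (?B y) x {1..n + 1} = 0)"
    using Suc by (simp only: higher_derivations_Suc_iff additive_leibniz_defect simp_thms)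
  also have "\<dots> \<longleftrightarrow> (\<forall>x. alternating_sum A x {1..Suc n + 1} = 0)"
  proof (intro iffI allI)
    fix x assume "\<forall>y x. alternating_sum (?B y) x {1..n + 1} = 0"
    then show "alternating_sum A x {1..Suc n + 1} = 0" unfolding step by blast
  next
    fix y x assume *: "\<forall>x. alternating_sum A x {1..Suc n + 1} = 0"
    \<comment> \<open>The index \<open>n + 2\<close> lies outside \<open>{1..n + 1}\<close>, so the
      value of \<open>x\<close> there can be set to the given \<open>y\<close> without changing the
      sum.\<close>
    have "alternating_sum (?B y) x {1..n + 1} =
        alternating_sum (?B y) (x(n + 2 := y)) {1..n + 1}"
      by (rule alternating_sum_cong) auto
    then show "alternating_sum (?B y) x {1..n + 1} = 0"
      using *[unfolded step, rule_format, of "x(n + 2 := y)"] by simp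
  qed
  finally show ?case .
qed

lemma alternating_sum_by_card:
  "alternating_sum A x {1..n+1} =
    (\<Sum>i=0..n. signed i
      (\<Sum>I | I \<subseteq> {1..n+1} \<and> card I = i.
        (if I = {} then A (nonempty_prod x {1..n+1})
         else nonempty_prod x I * A (nonempty_prod x ({1..n+1} - I)))))"
proof -
  let ?S = "{1..n+1}"
  let ?f = "\<lambda>I. prod_times x I (A (nonempty_prod x (?S - I)))"
  have "card I \<le> n" if "I \<in> Pow ?S - {?S}" for I
    using that psubset_card_mono[of ?S I] by (simp add: psubset_eq)
  then have "card ` (Pow ?S - {?S}) \<subseteq> {0..n}"
    by (simp only: image_subset_iff atLeastAtMost_iff le0 simp_thms Ball_def) blast
  then have "alternating_sum A x ?S =
      (\<Sum>i=0..n. \<Sum>I | I \<in> Pow ?S - {?S} \<and> card I = i. signed (card I) (?f I))"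
    unfolding alternating_sum_def by (intro sum.group[symmetric]) simp_all
  \<comment> \<open>As \<open>?S\<close> has \<open>n + 1\<close> elements,
    \<open>card I = i\<close> with \<open>i \<le> n\<close> already excludes
    \<open>I = ?S\<close>.\<close>
  also have "\<dots> = (\<Sum>i=0..n. signed i (\<Sum>I | I \<subseteq> ?S \<and> card I = i. ?f I))"
    unfolding signed_sum by (intro sum.cong refl) auto
  also have "\<dots> = (\<Sum>i=0..n. signed i
      (\<Sum>I | I \<subseteq> ?S \<and> card I = i.
        (if I = {} then A (nonempty_prod x ?S)
         else nonempty_prod x I * A (nonempty_prod x (?S - I)))))"
    by (intro sum.cong arg_cong[where f = "signed _"] refl) (simp add: prod_times_def)
  finally show ?thesis .
qed

theorem theorem3:
  fixes A :: "'a::comm_ring \<Rightarrow> 'a" and n :: nat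
  assumes "n \<ge> 1" and "additive A"
  shows "A \<in> higher_derivations n \<longleftrightarrow>
    (\<forall>x :: nat \<Rightarrow> 'a.
      (\<Sum>i=0..n. signed i
        (\<Sum>I | I \<subseteq> {1..n+1} \<and> card I = i.
          (if I = {} then A (nonempty_prod x {1..n+1})
           else nonempty_prod x I * A (nonempty_prod x ({1..n+1} - I))))) = 0)"
  unfolding alternating_sum_by_card[symmetric]
  using assms(2) by (rule higher_derivations_iff_alternating_sum)

end
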